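(* Let $0<\varepsilon<1$, $0<\beta\le 1$, let $\Pi=(\mathcal{M},w,\ell,\Lambda)$ be an instance of the multi-parametric matroid $\ell$-interdiction problem, and let $c\subseteq\Lambda$ be a cell of the arrangement $A(H^=)$. Then the Cell Algorithm (described in the context) computes a $(1-\varepsilon)\beta$-approximation for the parameter set $c$; that is, it returns a finite set $S$ of subsets $F\subseteq E$ with $|F|=\ell$ such that for every $\lambda\in c$ there is $F\in S$ with $y_F(\lambda)\ge(1-\varepsilon)\beta\, y(\lambda)$.
   Context: Setting. $\mathcal{M}=(E,\mathcal{F})$ is a matroid with finite ground set $E$, $|E|=m$, independent sets $\mathcal F$ and rank $k$; $\ell\in\mathbb{N}_{>0}$; $p\ge 1$ is the number of parameters. Each $e\in E$ has the weight $w(e,\lambda)=a_e+\lambda_1b_{1,e}+\dots+\lambda_pb_{p,e}$ with rational $a_e,b_{1,e},\dots,b_{p,e}$, where $\lambda=(\lambda_1,\dots,\lambda_p)$ ranges over a parameter polytope $\Lambda\subseteq\mathbb{R}^p$ defined by $q$ half-spaces. The weight of a basis is $w(B,\lambda)=\sum_{e\in B}w(e,\lambda)$. For $F\subseteq E$ let $\mathcal{M}_F$ be the restriction of $\mathcal{M}$ to $E\setminus F$, let $B_\lambda^F$ be a minimum weight basis of $\mathcal{M}_F$ at $\lambda$, and let $y_F:\Lambda\to\mathbb{R}$, $y_F(\lambda)=w(B_\lambda^F,\lambda)$. The optimal interdiction value function is $y(\lambda)=\max\{y_F(\lambda):F\subseteq E,\ |F|=\ell\}$. An interdiction strategy is a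 set $F\subseteq E$ with $|F|=\ell$. The multi-parametric matroid $\ell$-interdiction problem asks, for each $\lambda\in\Lambda$, for an interdiction strategy $F^*$ with $y_{F^*}(\lambda)=y(\lambda)$, together with the value $y(\lambda)$. Standing assumptions. (a) For every $\lambda\in\Lambda$ and $F\subseteq E$ with $|F|=\ell$ there is a basis $B_\lambda^F$ of cardinality $k$. (b) No separating hyperplane $h(e,f)$ (defined below) is vertical, i.e. contains a line parallel to the $p$-th coordinate axis. (c) All $a_e,b_{1,e},\dots,b_{p,e}$ are $\ge 0$; at most $k-1$ of the values $a_e$ ($e\in E$) are zero and, for each $i=1,\dots,p$, at most $k-1$ of the values $b_{i,e}$ ($e\in E$) are zero. (d) $\Lambda$ is compact and contained in the non-negative orthant. Arrangement. For $e,f\in E$ with $e\neq f$, $h(e,f)=\{\lambda\in\mathbb{R}^p: w(e,\lambda)=w(f,\lambda)\}$ is the separating hyperplane, with open sides $h^<(e,f)=\{\lambda: w(e,\lambda)<w(f,\lambda)\}$ and $h^>(e,f)=\{\lambda: w(e,\lambda)>w(f,\lambda)\}$. $H^=$ is the set of all separating hyperplanes together with all facet supporting hyperplanes of $\Lambda$. The faces of the arrangement $A(H^=)$ are the nonempty sets obtained by choosing, for each hyperplane of $H^=$, either the hyperplane itself or one of its two open sides, and intersecting all these choices. A cell is a full-dimensional face contained in $\Lambda$; it is identified with its closure, so that $c$ is a polytope. Oracle. $\mathsf{ORC}_\beta$ is an oracle that, given $\lambda\in\Lambda$, returns a set $F\subseteq E$ with $|F|=\ell$ and $y_F(\lambda)\ge\beta\,y(\lambda)$.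 Cell Algorithm. Input: $\Pi$, $\varepsilon$, $c$. (1) Choose an arbitrary $\lambda_0$ in the interior of $c$. For an interdiction strategy $F$ put $\varphi(F)=\{(\lambda,z)\in\mathbb{R}^{p+1}: w(B_{\lambda_0}^F,\lambda)\le z\}$. Let $F_0=\mathsf{ORC}_\beta(\lambda_0)$, $S=\{F_0\}$ and $\mathcal{A}=\{(\lambda,z):\lambda\in c,\ z\in\mathbb{R}\}\cap\varphi(F_0)$. (2) Go through the vertices $(\lambda,z)$ of the polyhedron $\mathcal{A}$ one after the other; for each of them let $F=\mathsf{ORC}_\beta(\lambda)$, and if $(1-\varepsilon)\,w(B_{\lambda_0}^F,\lambda)>z$, then replace $S$ by $S\cup\{F\}$, replace $\mathcal{A}$ by $\mathcal{A}\cap\varphi(F)$, and restart step (2) with the new $\mathcal{A}$. (3) If all vertices of $\mathcal{A}$ have been examined without a restart, return $S$. *)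

theory Defs
  imports "HOL-Analysis.Analysis"
begin

locale matroid =
  fixes E :: "'e set" and Ind :: "'e set set"
  assumes finite_ground: "finite E"
    and indep_subset_ground: "I \<in> Ind \<Longrightarrow> I \<subseteq> E"
    and indep_empty: "{} \<in> Ind"
    and indep_subset: "I \<in> Ind \<Longrightarrow> J \<subseteq> I \<Longrightarrow> J \<in> Ind"
    and indep_exchange: "I \<in> Ind \<Longrightarrow> J \<in> Ind \<Longrightarrow> card I < card J
          \<Longrightarrow> \<exists>x \<in> J - I. insert x I \<in> Ind"

definition is_basis :: "'e set set \<Rightarrow> 'e set \<Rightarrow> bool" where
  "is_basis Ind B \<longleftrightarrow> B \<in> Ind \<and> (\<forall>I \<in> Ind. B \<subseteq> I \<longrightarrow> I = B)"

definition matroid_rank :: "'e set set \<Rightarrow> nat" where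
  "matroid_rank Ind = Max (card ` Ind)"

definition restrict_indep :: "'e set set \<Rightarrow> 'e set \<Rightarrow> 'e set set" where
  "restrict_indep Ind X = {I \<in> Ind. I \<subseteq> X}"

text \<open>
  The parameter space is \<open>real ^ 'p\<close>, so the number of parameters is \<open>CARD('p) \<ge> 1\<close>.  The order on
  the index type \<open>'p\<close> only serves to say which coordinate is the last one.
\<close>

definition weight :: "('e \<Rightarrow> real) \<Rightarrow> ('p::finite \<Rightarrow> 'e \<Rightarrow> real) \<Rightarrow> 'e \<Rightarrow> real ^ 'p \<Rightarrow> real" where
  "weight a b e lam = a e + (\<Sum>i\<in>UNIV. lam $ i * b i e)"

definition set_weight ::
    "('e \<Rightarrow> real) \<Rightarrow> ('p::finite \<Rightarrow> 'e \<Rightarrow> real) \<Rightarrow> 'e set \<Rightarrow> real ^ 'p \<Rightarrow> real" where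
  "set_weight a b B lam = (\<Sum>e\<in>B. weight a b e lam)"

definition strategies :: "'e set \<Rightarrow> nat \<Rightarrow> 'e set set" where
  "strategies E l = {F. F \<subseteq> E \<and> card F = l}"

definition min_weight_basis ::
    "'e set \<Rightarrow> 'e set set \<Rightarrow> ('e \<Rightarrow> real) \<Rightarrow> ('p::finite \<Rightarrow> 'e \<Rightarrow> real)
      \<Rightarrow> real ^ 'p \<Rightarrow> 'e set \<Rightarrow> 'e set \<Rightarrow> bool" where
  "min_weight_basis E Ind a b lam F D \<longleftrightarrow>
     is_basis (restrict_indep Ind (E - F)) D \<and>
     (\<forall>D'. is_basis (restrict_indep Ind (E - F)) D' \<longrightarrow> set_weight a b D lam \<le> set_weight a b D' lam)"

text \<open>
  Minimum weight bases need not be unique.  A choice of them, one for each parameter vector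
  and each interdiction strategy, is a function \<open>Bas\<close>; \<open>Bas lam F\<close> is the basis
  \<open>B\<close> with lower index \<open>lam\<close> and upper index \<open>F\<close>.
\<close>

definition min_basis_choice ::
    "'e set \<Rightarrow> 'e set set \<Rightarrow> ('e \<Rightarrow> real) \<Rightarrow> ('p::finite \<Rightarrow> 'e \<Rightarrow> real) \<Rightarrow> nat \<Rightarrow> (real ^ 'p) set
      \<Rightarrow> (real ^ 'p \<Rightarrow> 'e set \<Rightarrow> 'e set) \<Rightarrow> bool" where
  "min_basis_choice E Ind a b l \<Lambda> Bas \<longleftrightarrow>
     (\<forall>lam \<in> \<Lambda>. \<forall>F \<in> strategies E l. min_weight_basis E Ind a b lam F (Bas lam F))"

definition y_strategy ::
    "('e \<Rightarrow> real) \<Rightarrow> ('p::finite \<Rightarrow> 'e \<Rightarrow> real) \<Rightarrow> (real ^ 'p \<Rightarrow> 'e set \<Rightarrow> 'e set)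
      \<Rightarrow> 'e set \<Rightarrow> real ^ 'p \<Rightarrow> real" where
  "y_strategy a b Bas F lam = set_weight a b (Bas lam F) lam"

definition y_opt ::
    "'e set \<Rightarrow> ('e \<Rightarrow> real) \<Rightarrow> ('p::finite \<Rightarrow> 'e \<Rightarrow> real) \<Rightarrow> nat \<Rightarrow> (real ^ 'p \<Rightarrow> 'e set \<Rightarrow> 'e set)
      \<Rightarrow> real ^ 'p \<Rightarrow> real" where
  "y_opt E a b l Bas lam = Max ((\<lambda>F. y_strategy a b Bas F lam) ` strategies E l)"

definition sep_hyperplane ::
    "('e \<Rightarrow> real) \<Rightarrow> ('p::finite \<Rightarrow> 'e \<Rightarrow> real) \<Rightarrow> 'e \<Rightarrow> 'e \<Rightarrow> (real ^ 'p) set" where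
  "sep_hyperplane a b e f = {lam. weight a b e lam = weight a b f lam}"

definition sep_below ::
    "('e \<Rightarrow> real) \<Rightarrow> ('p::finite \<Rightarrow> 'e \<Rightarrow> real) \<Rightarrow> 'e \<Rightarrow> 'e \<Rightarrow> (real ^ 'p) set" where
  "sep_below a b e f = {lam. weight a b e lam < weight a b f lam}"

definition sep_above ::
    "('e \<Rightarrow> real) \<Rightarrow> ('p::finite \<Rightarrow> 'e \<Rightarrow> real) \<Rightarrow> 'e \<Rightarrow> 'e \<Rightarrow> (real ^ 'p) set" where
  "sep_above a b e f = {lam. weight a b e lam > weight a b f lam}"

definition vertical :: "(real ^ 'p::{finite,linorder}) set \<Rightarrow> bool" where
  "vertical h \<longleftrightarrow> (\<exists>x. \<forall>t. x + t *\<^sub>R axis (Max UNIV) 1 \<in> h)"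

text \<open>
  In an arrangement every hyperplane is represented by the collection consisting
  of the hyperplane itself and its two open sides; a face is a nonempty intersection
  of one choice from each of these collections.  If two elements have parallel but distinct weights,
  their separating hyperplane is empty and one of its sides is everything, so that it does not
  affect the faces.  If \<open>\<Lambda>\<close> is not full-dimensional, its facets have no unique supporting
  hyperplane, but then there are no cells.
\<close>

definition facet_hyperplanes :: "'v::euclidean_space set \<Rightarrow> 'v set set set" where
  "facet_hyperplanes \<Lambda> =
     {{{x. n \<bullet> x = d}, {x. n \<bullet> x < d}, {x. n \<bullet> x > d}} | n d.
        n \<noteq> 0 \<and> \<Lambda> \<subseteq> {x. n \<bullet> x \<le> d} \<and> (\<Lambda> \<inter> {x. n \<bullet> x = d}) facet_of \<Lambda>}"

definition arrangement ::
    "'e set \<Rightarrow> ('e \<Rightarrow> real) \<Rightarrow> ('p::finite \<Rightarrow> 'e \<Rightarrow> real) \<Rightarrow> (real ^ 'p) set \<Rightarrow> (real ^ 'p) set set set" where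
  "arrangement E a b \<Lambda> =
     {{sep_hyperplane a b e f, sep_below a b e f, sep_above a b e f} | e f. e \<in> E \<and> f \<in> E \<and> e \<noteq> f}
     \<union> facet_hyperplanes \<Lambda>"

definition arrangement_face :: "'v set set set \<Rightarrow> 'v set \<Rightarrow> bool" where
  "arrangement_face A C \<longleftrightarrow>
     C \<noteq> {} \<and> (\<exists>choice. (\<forall>h \<in> A. choice h \<in> h) \<and> C = (\<Inter>h\<in>A. choice h))"

definition is_cell :: "'v::euclidean_space set set set \<Rightarrow> 'v set \<Rightarrow> 'v set \<Rightarrow> bool" where
  "is_cell A \<Lambda> c \<longleftrightarrow>
     (\<exists>C. arrangement_face A C \<and> aff_dim C = int DIM('v) \<and> C \<subseteq> \<Lambda> \<and> c = closure C)"

locale interdiction_instance = matroid E Ind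
  for E :: "'e set" and Ind :: "'e set set" +
  fixes a :: "'e \<Rightarrow> real"
    and b :: "'p::{finite,linorder} \<Rightarrow> 'e \<Rightarrow> real"
    and l :: nat
    and \<Lambda> :: "(real ^ 'p::{finite,linorder}) set"
  assumes l_pos: "l > 0"
    and a_rat: "e \<in> E \<Longrightarrow> a e \<in> \<rat>"
    and b_rat: "e \<in> E \<Longrightarrow> b i e \<in> \<rat>"
    and polyhedron_Lambda: "polyhedron \<Lambda>"
    and basis_exists: "lam \<in> \<Lambda> \<Longrightarrow> F \<in> strategies E l
          \<Longrightarrow> \<exists>D. min_weight_basis E Ind a b lam F D \<and> card D = matroid_rank Ind"
    and not_vertical: "e \<in> E \<Longrightarrow> f \<in> E \<Longrightarrow> e \<noteq> f \<Longrightarrow> \<not> vertical (sep_hyperplane a b e f)"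
    and a_nonneg: "e \<in> E \<Longrightarrow> a e \<ge> 0"
    and b_nonneg: "e \<in> E \<Longrightarrow> b i e \<ge> 0"
    and a_zeros: "card {e \<in> E. a e = 0} < matroid_rank Ind"
    and b_zeros: "card {e \<in> E. b i e = 0} < matroid_rank Ind"
    and compact_Lambda: "compact \<Lambda>"
    and Lambda_nonneg: "lam \<in> \<Lambda> \<Longrightarrow> lam $ i \<ge> 0"

definition is_oracle ::
    "'e set \<Rightarrow> ('e \<Rightarrow> real) \<Rightarrow> ('p::finite \<Rightarrow> 'e \<Rightarrow> real) \<Rightarrow> nat \<Rightarrow> (real ^ 'p) set
      \<Rightarrow> (real ^ 'p \<Rightarrow> 'e set \<Rightarrow> 'e set) \<Rightarrow> real \<Rightarrow> (real ^ 'p \<Rightarrow> 'e set) \<Rightarrow> bool" where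
  "is_oracle E a b l \<Lambda> Bas \<beta> ORC \<longleftrightarrow>
     (\<forall>lam \<in> \<Lambda>. ORC lam \<in> strategies E l \<and>
        y_strategy a b Bas (ORC lam) lam \<ge> \<beta> * y_opt E a b l Bas lam)"

definition is_approximation ::
    "'e set \<Rightarrow> ('e \<Rightarrow> real) \<Rightarrow> ('p::finite \<Rightarrow> 'e \<Rightarrow> real) \<Rightarrow> nat \<Rightarrow> (real ^ 'p \<Rightarrow> 'e set \<Rightarrow> 'e set)
      \<Rightarrow> real \<Rightarrow> (real ^ 'p) set \<Rightarrow> 'e set set \<Rightarrow> bool" where
  "is_approximation E a b l Bas \<alpha> c S \<longleftrightarrow>
     finite S \<and> S \<subseteq> strategies E l \<and>
     (\<forall>lam \<in> c. \<exists>F \<in> S. y_strategy a b Bas F lam \<ge> \<alpha> * y_opt E a b l Bas lam)"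

definition phi ::
    "('e \<Rightarrow> real) \<Rightarrow> ('p::finite \<Rightarrow> 'e \<Rightarrow> real) \<Rightarrow> (real ^ 'p \<Rightarrow> 'e set \<Rightarrow> 'e set)
      \<Rightarrow> real ^ 'p \<Rightarrow> 'e set \<Rightarrow> ((real ^ 'p) \<times> real) set" where
  "phi a b Bas lam0 F = {(lam, z). set_weight a b (Bas lam0 F) lam \<le> z}"

text \<open>
  \<open>Running lam0 S A X\<close>: besides the point \<open>lam0\<close>, the set \<open>S\<close> and the polyhedron \<open>A\<close>, the
  state records the set \<open>X\<close> of those vertices of \<open>A\<close> that have been examined since step (2) was last
  (re)started.
\<close>

datatype ('e, 'v) state =
    Start
  | Running 'v "'e set set" "('v \<times> real) set" "('v \<times> real) set"
  | Returned "'e set set"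

text \<open>
  The choice of \<open>lam0\<close> and the order in which vertices are examined are nondeterministic.
\<close>

inductive cell_step ::
    "('e \<Rightarrow> real) \<Rightarrow> ('p::finite \<Rightarrow> 'e \<Rightarrow> real) \<Rightarrow> (real ^ 'p \<Rightarrow> 'e set \<Rightarrow> 'e set)
      \<Rightarrow> (real ^ 'p \<Rightarrow> 'e set) \<Rightarrow> real \<Rightarrow> (real ^ 'p) set
      \<Rightarrow> ('e, real ^ 'p) state \<Rightarrow> ('e, real ^ 'p) state \<Rightarrow> bool"
  for a b Bas ORC \<epsilon> c where
  initialise:
    "lam0 \<in> interior c \<Longrightarrow> F0 = ORC lam0
     \<Longrightarrow> cell_step a b Bas ORC \<epsilon> c Start
           (Running lam0 {F0} ((c \<times> UNIV) \<inter> phi a b Bas lam0 F0) {})"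
| restart:
    "(lam, z) extreme_point_of A \<Longrightarrow> (lam, z) \<notin> X \<Longrightarrow> F = ORC lam
     \<Longrightarrow> (1 - \<epsilon>) * set_weight a b (Bas lam0 F) lam > z
     \<Longrightarrow> cell_step a b Bas ORC \<epsilon> c (Running lam0 S A X)
           (Running lam0 (S \<union> {F}) (A \<inter> phi a b Bas lam0 F) {})"
| next_vertex:
    "(lam, z) extreme_point_of A \<Longrightarrow> (lam, z) \<notin> X \<Longrightarrow> F = ORC lam
     \<Longrightarrow> \<not> (1 - \<epsilon>) * set_weight a b (Bas lam0 F) lam > z
     \<Longrightarrow> cell_step a b Bas ORC \<epsilon> c (Running lam0 S A X) (Running lam0 S A (insert (lam, z) X))"
| return:
    "(\<And>v. v extreme_point_of A \<Longrightarrow> v \<in> X)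
     \<Longrightarrow> cell_step a b Bas ORC \<epsilon> c (Running lam0 S A X) (Returned S)"

text \<open>
  Total correctness: there is no infinite run from \<open>Start\<close>, and every run that cannot be continued
  has returned a set satisfying \<open>Q\<close>.
\<close>

definition computes :: "(('e, 'v) state \<Rightarrow> ('e, 'v) state \<Rightarrow> bool) \<Rightarrow> ('e set set \<Rightarrow> bool) \<Rightarrow> bool" where
  "computes step Q \<longleftrightarrow>
     (\<nexists>run :: nat \<Rightarrow> ('e, 'v) state. run 0 = Start \<and> (\<forall>i. step (run i) (run (Suc i)))) \<and>
     (\<forall>s. step\<^sup>*\<^sup>* Start s \<and> (\<nexists>s'. step s s') \<longrightarrow> (\<exists>S. s = Returned S \<and> Q S))"

end

theory Submission
  imports Defs
begin

text \<open>
  Inside a cell no two elements change their weight order.  A minimum weight basis depends only on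
  that order, so on the whole cell \<open>c\<close> the value \<open>y\<^sub>F\<close> agrees with the affine function
  \<open>lam \<mapsto> w (Bas lam0 F) lam\<close> of a single basis, fixed at the interior point \<open>lam0\<close>
  (\<open>value_on_cell\<close>).  Hence the set \<open>A\<close> kept by the algorithm is the epigraph over \<open>c\<close> of the maximum
  of the functions \<open>y\<^sub>F\<close> with \<open>F \<in> S\<close>.

  Termination: when \<open>F\<close> causes a restart at a vertex \<open>(lam, z)\<close>, then
  \<open>z < (1 - \<epsilon>) y\<^sub>F lam \<le> y\<^sub>F lam\<close>, whereas every member \<open>G\<close> of \<open>S\<close> has \<open>y\<^sub>G lam \<le> z\<close>.  So \<open>F\<close> is new,
  and there are only finitely many strategies.  Between two restarts each step examines a new vertex
  of a polyhedron, and those are finite in number, too.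

  Quality: when the algorithm returns, every vertex \<open>(lam, z)\<close> of \<open>A\<close> satisfies
  \<open>z \<ge> (1 - \<epsilon>) y\<^sub>F lam \<ge> (1 - \<epsilon>) \<beta> y lam \<ge> (1 - \<epsilon>) \<beta> y\<^sub>G lam\<close> for every strategy \<open>G\<close>, where \<open>F\<close> is the
  answer of \<open>ORC\<close> at \<open>lam\<close>.  For a fixed \<open>G\<close> the two ends of this chain compare the height
  \<open>z\<close> with an affine function of \<open>lam\<close>.  The difference is bounded below on \<open>A\<close>, because \<open>c\<close> is compact
  and weights are nonnegative, so it attains its minimum at a vertex
  (\<open>affine_bound_from_extreme_points\<close>) and the inequality extends from the vertices to all of \<open>A\<close>.
  The lowest point of \<open>A\<close> above a given \<open>lam\<close> has height \<open>y\<^sub>F lam\<close> for some \<open>F \<in> S\<close>; with \<open>G\<close> optimal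
  at \<open>lam\<close> this is the approximation guarantee.
\<close>

section \<open>Minimum weight bases depend only on the order of the weights\<close>

context matroid
begin

lemma matroid_restrict: "matroid (E - F) (restrict_indep Ind (E - F))"
proof
  show "finite (E - F)" using finite_ground by simp
  show "{} \<in> restrict_indep Ind (E - F)" using indep_empty by (simp add: restrict_indep_def)
next
  fix I J assume "I \<in> restrict_indep Ind (E - F)" "J \<in> restrict_indep Ind (E - F)" "card I < card J"
  then show "\<exists>x\<in>J - I. insert x I \<in> restrict_indep Ind (E - F)"
    using indep_exchange[of I J] by (auto simp: restrict_indep_def)
qed (use indep_subset in \<open>auto simp: restrict_indep_def\<close>)

lemma finite_indep: "I \<in> Ind \<Longrightarrow> finite I"
  using finite_ground indep_subset_ground finite_subset by blast

lemma indep_card_le_basis: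
  assumes "is_basis Ind B" "I \<in> Ind"
  shows "card I \<le> card B"
proof (rule ccontr)
  assume "\<not> card I \<le> card B"
  then obtain x where "x \<in> I - B" "insert x B \<in> Ind"
    using indep_exchange[of B I] assms by (auto simp: is_basis_def)
  with assms(1) show False by (auto simp: is_basis_def)
qed

lemma basis_if_card_eq:
  assumes "is_basis Ind B" "I \<in> Ind" "card I = card B"
  shows "is_basis Ind I"
  unfolding is_basis_def
proof (intro conjI ballI impI)
  fix J assume "J \<in> Ind" "I \<subseteq> J"
  then show "J = I"
    using indep_card_le_basis[OF assms(1)] assms(3) card_seteq[of J I] finite_indep by auto
qed (fact assms(2))

lemma basis_exchange:
  assumes B: "is_basis Ind B" and B': "is_basis Ind B'" and f: "f \<in> B - B'"
  obtains e where "e \<in> B' - B" "is_basis Ind (insert e (B - {f}))"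
proof -
  have ind: "B \<in> Ind" "B' \<in> Ind" using B B' by (auto simp: is_basis_def)
  have fin: "finite B" using ind finite_indep by blast
  have "card B \<le> card B'" using indep_card_le_basis[OF B' ind(1)] .
  moreover have "card B = Suc (card (B - {f}))"
    using f card_Suc_Diff1[OF fin, of f] by simp
  ultimately obtain e where e: "e \<in> B' - (B - {f})" "insert e (B - {f}) \<in> Ind"
    using indep_exchange[of "B - {f}" B'] indep_subset[OF ind(1)] ind(2) by auto
  have "card (insert e (B - {f})) = card B"
    using e fin \<open>card B = Suc (card (B - {f}))\<close> by simp
  then have "is_basis Ind (insert e (B - {f}))" using basis_if_card_eq[OF B e(2)] by simp
  moreover have "e \<in> B' - B" using e f by auto
  ultimately show thesis using that by blast
qed

text \<open>
  A competitor \<open>D'\<close> is turned into \<open>D\<close> by swaps that do not increase its \<open>w'\<close>-weight.  The element to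
  remove is a \<open>w\<close>-heaviest \<open>f \<in> D' - D\<close>.  Its replacement \<open>e \<in> D - D'\<close> cannot be \<open>w\<close>-heavier than \<open>f\<close>,
  since then it would be heavier than all of \<open>D' - D\<close>, and exchanging it out of \<open>D\<close> would give a basis
  lighter than \<open>D\<close>.
\<close>

lemma min_basis_order_invariant:
  fixes w w' :: "'e \<Rightarrow> real"
  assumes D: "is_basis Ind D"
    and min: "\<And>D'. is_basis Ind D' \<Longrightarrow> sum w D \<le> sum w D'"
    and order: "\<And>e f. e \<in> E \<Longrightarrow> f \<in> E \<Longrightarrow> w e \<le> w f \<Longrightarrow> w' e \<le> w' f"
  shows "is_basis Ind D' \<Longrightarrow> sum w' D \<le> sum w' D'"
proof (induction "card (D' - D)" arbitrary: D' rule: less_induct)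
  case less
  note D' = less.prems
  have ind: "D \<in> Ind" "D' \<in> Ind" using D D' by (auto simp: is_basis_def)
  have fin: "finite D" "finite D'" using ind finite_indep by auto
  have sub: "D \<subseteq> E" "D' \<subseteq> E" using ind indep_subset_ground by auto
  show ?case
  proof (cases "D' \<subseteq> D")
    case True
    then have "D' = D" using D' ind by (auto simp: is_basis_def)
    then show ?thesis by simp
  next
    case False
    have finD': "finite (D' - D)" using fin by simp
    obtain f where f: "f \<in> D' - D" and fmax: "\<And>g. g \<in> D' - D \<Longrightarrow> w g \<le> w f"
    proof -
      have "Max (w ` (D' - D)) \<in> w ` (D' - D)" using False finD' by (intro Max_in) auto
      then obtain f where "f \<in> D' - D" "w f = Max (w ` (D' - D))" by auto
      then show thesis using that finD' by auto
    qed
    obtain e where e: "e \<in> D - D'" and basis: "is_basis Ind (insert e (D' - {f}))"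
      using basis_exchange[OF D' D f] by blast
    have "w e \<le> w f"
    proof (rule ccontr)
      assume heavier: "\<not> w e \<le> w f"
      obtain g where g: "g \<in> D' - D" and B: "is_basis Ind (insert g (D - {e}))"
        using basis_exchange[OF D D' e] by blast
      have "sum w (insert g (D - {e})) = sum w D - w e + w g"
        using g e fin by (simp add: sum_diff1)
      then have "w e \<le> w g" using min[OF B] by simp
      with fmax[OF g] heavier show False by simp
    qed
    then have "w' e \<le> w' f" using order e f sub by auto
    moreover have "insert e (D' - {f}) - D \<subset> D' - D" using e f by auto
    then have "sum w' D \<le> sum w' (insert e (D' - {f}))"
      using less.hyps[OF _ basis] finD' psubset_card_mono by blast
    moreover have "sum w' (insert e (D' - {f})) = sum w' D' - w' f + w' e"
      using e f fin by (simp add: sum_diff1)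
    ultimately show ?thesis by simp
  qed
qed

end

lemma min_weight_basis_order_invariant:
  assumes "matroid E Ind"
    and D: "min_weight_basis E Ind a b lam0 F D"
    and order: "\<And>e f. e \<in> E \<Longrightarrow> f \<in> E \<Longrightarrow> weight a b e lam0 \<le> weight a b f lam0
        \<Longrightarrow> weight a b e lam \<le> weight a b f lam"
  shows "min_weight_basis E Ind a b lam F D"
proof -
  interpret M: matroid "E - F" "restrict_indep Ind (E - F)"
    using matroid.matroid_restrict[OF assms(1)] .
  show ?thesis
    using M.min_basis_order_invariant[of D "\<lambda>e. weight a b e lam0" "\<lambda>e. weight a b e lam"] D order
    by (auto simp: min_weight_basis_def set_weight_def)
qed

section \<open>Weights as affine functions\<close>

lemma weight_inner: "weight a b e lam = a e + (\<chi> i. b i e) \<bullet> lam"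
  by (simp add: weight_def inner_vec_def mult.commute)

lemma set_weight_inner:
  "set_weight a b B lam = sum a B + (\<chi> i. \<Sum>e\<in>B. b i e) \<bullet> lam"
proof -
  have "(\<Sum>e\<in>B. \<Sum>i\<in>UNIV. lam $ i * b i e) = (\<Sum>i\<in>UNIV. \<Sum>e\<in>B. lam $ i * b i e)"
    by (rule sum.swap)
  then show ?thesis
    by (simp add: set_weight_def weight_def inner_vec_def sum.distrib sum_distrib_left mult.commute)
qed

lemma weight_segment:
  "weight a b e ((1 - u) *\<^sub>R x + u *\<^sub>R y) = (1 - u) * weight a b e x + u * weight a b e y"
  by (simp add: weight_inner inner_add_right algebra_simps)

lemma polyhedron_weight_le: "polyhedron {lam. weight a b e lam \<le> weight a b f lam}"
proof -
  have "{lam. weight a b e lam \<le> weight a b f lam}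
      = {lam. ((\<chi> i. b i e) - (\<chi> i. b i f)) \<bullet> lam \<le> a f - a e}"
    by (auto simp: weight_inner inner_diff_left)
  then show ?thesis by (metis polyhedron_halfspace_le)
qed

lemma polyhedron_phi: "polyhedron (phi a b Bas lam0 F)"
proof -
  define B where "B = Bas lam0 F"
  have "phi a b Bas lam0 F = {p. ((\<chi> i. \<Sum>e\<in>B. b i e), -1) \<bullet> p \<le> - sum a B}"
    by (auto simp: phi_def set_weight_inner B_def)
  then show ?thesis by (metis polyhedron_halfspace_le)
qed

text \<open>An affine function that is nonnegative near one of its zeros vanishes identically.\<close>

lemma weights_eq_if_touching_in_interior:
  assumes le: "\<And>x. x \<in> c \<Longrightarrow> weight a b f x \<le> weight a b e x"
    and lam0: "lam0 \<in> interior c"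
    and touch: "weight a b e lam0 \<le> weight a b f lam0"
  shows "weight a b e lam = weight a b f lam"
proof -
  obtain r where r: "r > 0" "cball lam0 r \<subseteq> c" using lam0 mem_interior_cball by blast
  define n where "n = (\<chi> i. b i e) - (\<chi> i. b i f)"
  have diff: "weight a b e x - weight a b f x = (a e - a f) + n \<bullet> x" for x
    by (simp add: n_def weight_inner inner_diff_left)
  have zero: "(a e - a f) + n \<bullet> lam0 = 0"
    using touch le[of lam0] lam0 interior_subset[of c] diff[of lam0] by force
  have "n = 0"
  proof (rule ccontr)
    assume "n \<noteq> 0"
    \<comment> \<open>Moving against the gradient would make the difference negative.\<close>
    define x where "x = lam0 - (r / norm n) *\<^sub>R n"
    have "x \<in> c" using r by (intro subsetD[OF r(2)]) (simp add: x_def dist_norm)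
    then have "0 \<le> (a e - a f) + n \<bullet> x" using le[of x] diff[of x] by simp
    then have "(r / norm n) * (n \<bullet> n) \<le> 0" using zero by (simp add: x_def inner_diff_right)
    moreover have "(r / norm n) * (n \<bullet> n) > 0" using \<open>n \<noteq> 0\<close> r by (intro mult_pos_pos) auto
    ultimately show False by simp
  qed
  then show ?thesis using zero diff[of lam] by simp
qed

section \<open>Polyhedra\<close>

lemma polyhedron_cylinder:
  fixes S :: "'v::euclidean_space set"
  assumes "polyhedron S"
  shows "polyhedron (S \<times> (UNIV :: 'w::euclidean_space set))"
proof -
  obtain H where H: "finite H" "S = \<Inter>H" "\<And>h. h \<in> H \<Longrightarrow> \<exists>n d. n \<noteq> 0 \<and> h = {x. n \<bullet> x \<le> d}"
    using assms unfolding polyhedron_def by blast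
  have "polyhedron (h \<times> (UNIV :: 'w set))" if "h \<in> H" for h
  proof -
    obtain n d where "h = {x. n \<bullet> x \<le> d}" using H(3) \<open>h \<in> H\<close> by blast
    then have "h \<times> (UNIV :: 'w set) = {p. (n, 0) \<bullet> p \<le> d}" by auto
    then show ?thesis by (metis polyhedron_halfspace_le)
  qed
  moreover have "S \<times> (UNIV :: 'w set) = (\<Inter>h\<in>H. h \<times> UNIV)" using H(2) by auto
  ultimately show ?thesis using H(1) by (auto intro!: polyhedron_Inter)
qed

text \<open>
  \<open>A\<close> itself may be unbounded upwards, but the linear functional \<open>z - n \<bullet> x\<close> has compact sublevel
  sets on it, hence a minimum.  The minimisers form a compact face, and an extreme point of a face is an
  extreme point of \<open>A\<close>.
\<close>

lemma affine_bound_from_extreme_points: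
  fixes A :: "('v::euclidean_space \<times> real) set"
  assumes "closed A" "convex A" "bounded K" and sub: "A \<subseteq> K \<times> {0..}"
    and vertices: "\<And>x z. (x, z) extreme_point_of A \<Longrightarrow> d + n \<bullet> x \<le> z"
    and "(x1, z1) \<in> A"
  shows "d + n \<bullet> x1 \<le> z1"
proof -
  define g :: "'v \<times> real" where "g = (- n, 1)"
  have g: "g \<bullet> (x, z) = z - n \<bullet> x" for x z by (simp add: g_def)
  define T where "T = A \<inter> {p. g \<bullet> p \<le> g \<bullet> (x1, z1)}"
  obtain R where R: "\<And>x. x \<in> K \<Longrightarrow> norm x \<le> R" using \<open>bounded K\<close> by (auto simp: bounded_iff)
  have "T \<subseteq> K \<times> {0..g \<bullet> (x1, z1) + norm n * R}"
  proof
    fix p assume "p \<in> T"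
    then obtain x z where p: "p = (x, z)" "x \<in> K" "0 \<le> z" "g \<bullet> (x, z) \<le> g \<bullet> (x1, z1)"
      using sub by (cases p) (auto simp: T_def)
    have "n \<bullet> x \<le> norm n * norm x" by (rule norm_cauchy_schwarz)
    also have "\<dots> \<le> norm n * R" using R p by (intro mult_left_mono) auto
    finally show "p \<in> K \<times> {0..g \<bullet> (x1, z1) + norm n * R}" using p g[of x z] by simp
  qed
  then have "bounded T" using \<open>bounded K\<close> bounded_Times bounded_subset bounded_closed_interval by metis
  moreover have "closed T"
    unfolding T_def using \<open>closed A\<close> by (intro closed_Int closed_halfspace_le)
  ultimately have "compact T" by (simp add: compact_eq_bounded_closed)
  moreover have "(x1, z1) \<in> T" using \<open>(x1, z1) \<in> A\<close> by (simp add: T_def)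
  moreover have "continuous_on T (\<lambda>p. g \<bullet> p)" by (intro continuous_intros)
  ultimately obtain p0 where p0: "p0 \<in> T" and least: "\<And>p. p \<in> T \<Longrightarrow> g \<bullet> p0 \<le> g \<bullet> p"
    using continuous_attains_inf[of T "\<lambda>p. g \<bullet> p"] by blast
  have lower: "g \<bullet> p0 \<le> g \<bullet> p" if "p \<in> A" for p
    using least[of p] p0 that by (force simp: T_def)
  define M where "M = A \<inter> {p. g \<bullet> p = g \<bullet> p0}"
  have face: "M face_of A"
    unfolding M_def using \<open>convex A\<close> lower by (intro face_of_Int_supporting_hyperplane_ge)
  have "M = T \<inter> {p. g \<bullet> p = g \<bullet> p0}" using p0 by (auto simp: M_def T_def)
  then have "compact M" using \<open>compact T\<close> by (simp add: compact_Int_closed closed_hyperplane)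
  moreover have "convex M" using face by (rule face_of_imp_convex)
  moreover have "p0 \<in> M" using p0 by (simp add: M_def T_def)
  ultimately obtain v where "v extreme_point_of M" using extreme_point_exists_convex by blast
  then have v: "v extreme_point_of A" "v \<in> M" using extreme_point_of_face[OF face] by auto
  obtain x z where xz: "v = (x, z)" by (cases v)
  have "d \<le> g \<bullet> v" using vertices[of x z] v xz g[of x z] by simp
  also have "\<dots> = g \<bullet> p0" using v by (simp add: M_def)
  also have "\<dots> \<le> g \<bullet> (x1, z1)" using lower \<open>(x1, z1) \<in> A\<close> by blast
  finally show ?thesis using g[of x1 z1] by simp
qed

section \<open>Cells of the arrangement\<close>

lemma open_segment_subset_imp_mem_closure:
  fixes x y :: "'v::euclidean_space"
  assumes "open_segment y x \<subseteq> C" "y \<in> C"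
  shows "x \<in> closure C"
proof (cases "y = x")
  case True
  then show ?thesis using assms closure_subset by blast
next
  case False
  then have "x \<in> closure (open_segment y x)" by simp
  then show ?thesis using assms closure_mono by blast
qed

text \<open>
  A facet hyperplane of \<open>\<Lambda>\<close> cannot contain the full-dimensional \<open>C \<subseteq> \<Lambda>\<close>, so its open inner side is
  the one chosen for \<open>C\<close>, and this side contains every point strictly between a point of \<open>C\<close> and a
  point of \<open>\<Lambda>\<close>.
\<close>

lemma facet_choice_segment:
  fixes \<Lambda> C :: "'v::euclidean_space set"
  assumes h: "h \<in> facet_hyperplanes \<Lambda>" and Q: "Q \<in> h" and "C \<subseteq> Q" "C \<subseteq> \<Lambda>"
    and dim: "aff_dim C = int DIM('v)"
    and y: "y \<in> C" and x: "x \<in> \<Lambda>" and u: "0 < u" "u < 1"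
  shows "(1 - u) *\<^sub>R y + u *\<^sub>R x \<in> Q"
proof -
  obtain n d where n: "n \<noteq> 0" and le: "\<Lambda> \<subseteq> {x. n \<bullet> x \<le> d}"
    and hyp: "h = {{x. n \<bullet> x = d}, {x. n \<bullet> x < d}, {x. n \<bullet> x > d}}"
    using h unfolding facet_hyperplanes_def by blast
  have "Q \<noteq> {x. n \<bullet> x = d}"
  proof
    assume "Q = {x. n \<bullet> x = d}"
    then have "aff_dim C \<le> aff_dim {x. n \<bullet> x = d}" using \<open>C \<subseteq> Q\<close> aff_dim_subset by blast
    then show False using dim n by simp
  qed
  moreover have "n \<bullet> y \<le> d" using y \<open>C \<subseteq> \<Lambda>\<close> le by auto
  then have "Q \<noteq> {x. n \<bullet> x > d}" using y \<open>C \<subseteq> Q\<close> by auto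
  ultimately have Q': "Q = {x. n \<bullet> x < d}" using Q hyp by auto
  have "(1 - u) * (n \<bullet> y) < (1 - u) * d" using y \<open>C \<subseteq> Q\<close> Q' u by auto
  moreover have "u * (n \<bullet> x) \<le> u * d" using x le u by auto
  ultimately show ?thesis by (simp add: Q' inner_add_right algebra_simps)
qed

text \<open>
  This exhibits the closure of a full-dimensional face in \<open>\<Lambda>\<close> as a polyhedron.  On a segment from a
  point of \<open>C\<close> to a point with the same weak weight order, strict inequalities persist up to, but
  possibly not including, the last point; so that point is a limit of points of \<open>C\<close>.
\<close>

lemma closure_face_eq:
  fixes \<Lambda> C :: "(real ^ 'p::finite) set"
  assumes face: "arrangement_face (arrangement E a b \<Lambda>) C" and dim: "aff_dim C = int CARD('p)"
    and "C \<subseteq> \<Lambda>" "closed \<Lambda>"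
  shows "closure C = \<Lambda> \<inter> (\<Inter>(e, f)\<in>{(e, f) \<in> E \<times> E. \<forall>x\<in>C. weight a b e x \<le> weight a b f x}.
      {x. weight a b e x \<le> weight a b f x})" (is "_ = \<Lambda> \<inter> ?W")
proof
  have "closed ?W" by (intro closed_INT) (auto intro: polyhedron_imp_closed polyhedron_weight_le)
  then show "closure C \<subseteq> \<Lambda> \<inter> ?W"
    using \<open>C \<subseteq> \<Lambda>\<close> \<open>closed \<Lambda>\<close> by (intro closure_minimal) auto
next
  obtain choice where "C \<noteq> {}"
    and choice: "\<And>h. h \<in> arrangement E a b \<Lambda> \<Longrightarrow> choice h \<in> h"
    and C: "C = (\<Inter>h\<in>arrangement E a b \<Lambda>. choice h)"
    using face by (auto simp: arrangement_face_def)
  obtain y where y: "y \<in> C" using \<open>C \<noteq> {}\<close> by blast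
  show "\<Lambda> \<inter> ?W \<subseteq> closure C"
  proof
    fix x assume x: "x \<in> \<Lambda> \<inter> ?W"
    have xle: "weight a b e x \<le> weight a b f x"
      if "e \<in> E" "f \<in> E" "\<And>x. x \<in> C \<Longrightarrow> weight a b e x \<le> weight a b f x" for e f
      using x that by auto
    have "p \<in> choice h" if p: "p \<in> open_segment y x" and h: "h \<in> arrangement E a b \<Lambda>" for p h
    proof -
      obtain u where u: "0 < u" "u < 1" and pu: "p = (1 - u) *\<^sub>R y + u *\<^sub>R x"
        using p by (auto simp: in_segment)
      have sub: "C \<subseteq> choice h" using C h by blast
      show ?thesis
      proof (cases "h \<in> facet_hyperplanes \<Lambda>")
        case True
        show ?thesis
          unfolding pu
          using facet_choice_segment[OF True choice[OF h] sub \<open>C \<subseteq> \<Lambda>\<close> _ y _ u] dim x by simp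
      next
        case False
        then obtain e f where ef: "e \<in> E" "f \<in> E"
          and hyp: "h = {sep_hyperplane a b e f, sep_below a b e f, sep_above a b e f}"
          using h by (auto simp: arrangement_def)
        have strict: "(1 - u) * s + u * s' < (1 - u) * t + u * t'" if "s < t" "s' \<le> t'" for s s' t t'
          using that u by (intro add_less_le_mono) auto
        consider "choice h = sep_hyperplane a b e f" | "choice h = sep_below a b e f"
          | "choice h = sep_above a b e f"
          using choice[OF h] hyp by auto
        then show ?thesis
        proof cases
          case 1
          then have eq: "weight a b e x = weight a b f x" if "x \<in> C" for x
            using sub that by (auto simp: sep_hyperplane_def)
          then have "weight a b e x = weight a b f x"
            using xle[of e f] xle[of f e] ef by (simp add: order_antisym)
          then show ?thesis using eq[OF y] 1 by (simp add: sep_hyperplane_def pu weight_segment)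
        next
          case 2
          then have lt: "weight a b e x < weight a b f x" if "x \<in> C" for x
            using sub that by (auto simp: sep_below_def)
          then have "weight a b e x \<le> weight a b f x"
            using xle[of e f] ef by (simp add: less_imp_le)
          then show ?thesis
            using strict[OF lt[OF y]] 2 by (simp add: sep_below_def pu weight_segment)
        next
          case 3
          then have gt: "weight a b f x < weight a b e x" if "x \<in> C" for x
            using sub that by (auto simp: sep_above_def)
          then have "weight a b f x \<le> weight a b e x"
            using xle[of f e] ef by (simp add: less_imp_le)
          then show ?thesis
            using strict[OF gt[OF y]] 3 by (simp add: sep_above_def pu weight_segment)
        qed
      qed
    qed
    then have "open_segment y x \<subseteq> C" using C by auto
    then show "x \<in> closure C" using y by (rule open_segment_subset_imp_mem_closure)
  qed
qed

lemma face_weight_order: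
  assumes "arrangement_face (arrangement E a b \<Lambda>) C" and ef: "e \<in> E" "f \<in> E"
  shows "(\<forall>x\<in>C. weight a b e x < weight a b f x) \<or> (\<forall>x\<in>C. weight a b f x \<le> weight a b e x)"
proof (cases "e = f")
  case False
  let ?h = "{sep_hyperplane a b e f, sep_below a b e f, sep_above a b e f}"
  have "?h \<in> arrangement E a b \<Lambda>" using ef False by (auto simp: arrangement_def)
  moreover obtain choice where "\<And>h. h \<in> arrangement E a b \<Lambda> \<Longrightarrow> choice h \<in> h"
    "C = (\<Inter>h\<in>arrangement E a b \<Lambda>. choice h)"
    using assms(1) by (auto simp: arrangement_face_def)
  ultimately have "choice ?h \<in> ?h" "C \<subseteq> choice ?h" by auto
  then have "C \<subseteq> sep_hyperplane a b e f \<or> C \<subseteq> sep_below a b e f \<or> C \<subseteq> sep_above a b e f"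
    by auto
  then show ?thesis
    by (auto simp: sep_hyperplane_def sep_below_def sep_above_def subset_iff less_imp_le)
qed simp

section \<open>Invariant and termination of the Cell Algorithm\<close>

locale cell_algorithm = interdiction_instance E Ind a b l \<Lambda>
  for E :: "'e set" and Ind and a and b :: "'p::{finite,linorder} \<Rightarrow> 'e \<Rightarrow> real" and l \<Lambda> +
  fixes c Bas ORC and \<epsilon> \<beta> :: real
  assumes eps: "0 < \<epsilon>" "\<epsilon> < 1"
    and beta: "0 < \<beta>"
    and choice: "min_basis_choice E Ind a b l \<Lambda> Bas"
    and orc: "is_oracle E a b l \<Lambda> Bas \<beta> ORC"
    and cell: "is_cell (arrangement E a b \<Lambda>) \<Lambda> c"
begin

lemma cell_face:
  obtains C where "arrangement_face (arrangement E a b \<Lambda>) C" "aff_dim C = int CARD('p)"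
    "C \<subseteq> \<Lambda>" "c = closure C"
  using cell by (auto simp: is_cell_def)

lemma cell_subset: "c \<subseteq> \<Lambda>"
proof -
  obtain C where "C \<subseteq> \<Lambda>" "c = closure C" using cell_face .
  then show ?thesis using compact_Lambda compact_imp_closed closure_minimal by blast
qed

lemma bounded_cell: "bounded c"
  using cell_subset compact_Lambda compact_imp_bounded bounded_subset by blast

lemma polyhedron_cell: "polyhedron c"
proof -
  obtain C where C: "arrangement_face (arrangement E a b \<Lambda>) C" "aff_dim C = int CARD('p)"
    "C \<subseteq> \<Lambda>" "c = closure C" using cell_face .
  have "finite {(e, f) \<in> E \<times> E. \<forall>x\<in>C. weight a b e x \<le> weight a b f x}"
    by (rule finite_subset[of _ "E \<times> E"]) (use finite_ground in auto)
  then show ?thesis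
    unfolding C(4) closure_face_eq[OF C(1-3) compact_imp_closed[OF compact_Lambda]]
    using polyhedron_Lambda by (auto intro!: polyhedron_Int polyhedron_Inter polyhedron_weight_le)
qed

lemma interior_cell_nonempty: "interior c \<noteq> {}"
proof -
  obtain C where C: "arrangement_face (arrangement E a b \<Lambda>) C" "aff_dim C = int CARD('p)"
    "c = closure C" using cell_face .
  have "affine hull c = UNIV"
    using C(2) aff_dim_eq_full[of C] unfolding C(3) by (simp add: closure_same_affine_hull)
  moreover have "c \<noteq> {}" using C by (auto simp: arrangement_face_def)
  ultimately show ?thesis
    using rel_interior_eq_empty[OF polyhedron_imp_convex[OF polyhedron_cell]] rel_interior_interior
    by metis
qed

text \<open>
  The weak order common to all of \<open>c\<close> could be the opposite of the one assumed at \<open>lam0\<close> only if the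
  two weights tie there; since \<open>lam0\<close> is interior, they then tie everywhere.
\<close>

lemma cell_weight_order:
  assumes "lam0 \<in> interior c" "lam \<in> c" "e \<in> E" "f \<in> E" "weight a b e lam0 \<le> weight a b f lam0"
  shows "weight a b e lam \<le> weight a b f lam"
proof -
  obtain C where C: "arrangement_face (arrangement E a b \<Lambda>) C" "c = closure C" using cell_face .
  have extend: "\<forall>x\<in>c. weight a b g x \<le> weight a b h x"
    if "\<forall>x\<in>C. weight a b g x \<le> weight a b h x" for g h
  proof -
    have "c \<subseteq> {x. weight a b g x \<le> weight a b h x}"
      unfolding C(2) using that
      by (intro closure_minimal polyhedron_imp_closed[OF polyhedron_weight_le]) auto
    then show ?thesis by blast
  qed
  consider "\<forall>x\<in>C. weight a b e x < weight a b f x" | "\<forall>x\<in>C. weight a b f x \<le> weight a b e x"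
    using face_weight_order[OF C(1)] assms by blast
  then show ?thesis
  proof cases
    case 1
    then show ?thesis using extend[of e f] assms(2) by (simp add: less_imp_le)
  next
    case 2
    then have "weight a b f x \<le> weight a b e x" if "x \<in> c" for x
      using extend[of f e] that by blast
    then have "weight a b e lam = weight a b f lam"
      using assms(1,5) by (rule weights_eq_if_touching_in_interior)
    then show ?thesis by simp
  qed
qed

lemma value_on_cell:
  assumes lam0: "lam0 \<in> interior c" and lam: "lam \<in> c" and F: "F \<in> strategies E l"
  shows "set_weight a b (Bas lam0 F) lam = y_strategy a b Bas F lam"
proof -
  have \<Lambda>: "lam0 \<in> \<Lambda>" "lam \<in> \<Lambda>" using assms cell_subset interior_subset by blast+
  then have "min_weight_basis E Ind a b lam0 F (Bas lam0 F)"
    and at_lam: "min_weight_basis E Ind a b lam F (Bas lam F)"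
    using choice F by (auto simp: min_basis_choice_def)
  then have "min_weight_basis E Ind a b lam F (Bas lam0 F)"
    using min_weight_basis_order_invariant[OF matroid_axioms] cell_weight_order[OF lam0 lam] by blast
  with at_lam show ?thesis
    by (auto simp: min_weight_basis_def y_strategy_def intro: order_antisym)
qed

lemma value_nonneg:
  assumes "lam \<in> \<Lambda>" "F \<in> strategies E l"
  shows "0 \<le> y_strategy a b Bas F lam"
proof -
  have "min_weight_basis E Ind a b lam F (Bas lam F)"
    using choice assms by (simp add: min_basis_choice_def)
  then have "Bas lam F \<subseteq> E"
    by (auto simp: min_weight_basis_def is_basis_def restrict_indep_def)
  then show ?thesis
    unfolding y_strategy_def set_weight_def weight_def
    using a_nonneg b_nonneg Lambda_nonneg[OF assms(1)]
    by (intro sum_nonneg add_nonneg_nonneg mult_nonneg_nonneg) auto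
qed

lemma finite_strategies: "finite (strategies E l)"
  using finite_ground by (simp add: strategies_def)

lemma oracle_strategy: "lam \<in> \<Lambda> \<Longrightarrow> ORC lam \<in> strategies E l"
  using orc by (simp add: is_oracle_def)

lemma oracle_value:
  assumes "lam \<in> \<Lambda>" "G \<in> strategies E l"
  shows "\<beta> * y_strategy a b Bas G lam \<le> y_strategy a b Bas (ORC lam) lam"
proof -
  have "y_strategy a b Bas G lam \<le> y_opt E a b l Bas lam"
    unfolding y_opt_def using assms finite_strategies by (intro Max_ge) auto
  then have "\<beta> * y_strategy a b Bas G lam \<le> \<beta> * y_opt E a b l Bas lam" using beta by simp
  then show ?thesis using orc assms(1) by (force simp: is_oracle_def)
qed

definition region :: "real ^ 'p::{finite,linorder} \<Rightarrow> 'e set set \<Rightarrow> ((real ^ 'p::{finite,linorder}) \<times> real) set" where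
  "region lam0 S = (c \<times> UNIV) \<inter> (\<Inter>F\<in>S. phi a b Bas lam0 F)"

lemma mem_region_iff:
  assumes "lam0 \<in> interior c" "S \<subseteq> strategies E l"
  shows "(lam, z) \<in> region lam0 S \<longleftrightarrow> lam \<in> c \<and> (\<forall>F\<in>S. y_strategy a b Bas F lam \<le> z)"
  using assms value_on_cell[of lam0 lam] by (force simp: region_def phi_def)

lemma polyhedron_region:
  assumes "S \<subseteq> strategies E l"
  shows "polyhedron (region lam0 S)"
  unfolding region_def using finite_subset[OF assms finite_strategies]
  by (intro polyhedron_Int polyhedron_cylinder polyhedron_cell polyhedron_Inter)
    (auto simp: polyhedron_phi)

text \<open>
  The region is compared with each strategy \<open>G\<close> separately, because a single \<open>y\<^sub>G\<close> is affine on the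
  cell, as the extension from vertices requires, while the maximum \<open>y\<close> is only convex.
\<close>

lemma approximation_if_vertices_examined:
  assumes lam0: "lam0 \<in> interior c" and S: "S \<subseteq> strategies E l" "S \<noteq> {}"
    and vertices: "\<And>lam z. (lam, z) extreme_point_of region lam0 S
        \<Longrightarrow> (1 - \<epsilon>) * set_weight a b (Bas lam0 (ORC lam)) lam \<le> z"
  shows "is_approximation E a b l Bas ((1 - \<epsilon>) * \<beta>) c S"
proof -
  let ?y = "y_strategy a b Bas"
  have poly: "polyhedron (region lam0 S)" using S polyhedron_region by blast
  have bound: "(1 - \<epsilon>) * \<beta> * ?y G lam \<le> z"
    if G: "G \<in> strategies E l" and mem: "(lam, z) \<in> region lam0 S" for G lam z
  proof -
    let ?k = "(1 - \<epsilon>) * \<beta>" and ?B = "Bas lam0 G"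
    let ?d = "?k * sum a ?B" and ?n = "?k *\<^sub>R (\<chi> i. \<Sum>e\<in>?B. b i e)"
    have affine: "?d + ?n \<bullet> x = ?k * ?y G x" if "x \<in> c" for x
      unfolding value_on_cell[OF lam0 that G, symmetric] set_weight_inner
      by (simp add: distrib_left)
    have "?d + ?n \<bullet> lam \<le> z"
    proof (rule affine_bound_from_extreme_points[OF _ _ bounded_cell _ _ mem])
      show "closed (region lam0 S)" "convex (region lam0 S)"
        using poly polyhedron_imp_closed polyhedron_imp_convex by auto
      show "region lam0 S \<subseteq> c \<times> {0..}"
      proof
        fix p assume "p \<in> region lam0 S"
        moreover obtain x z' where p: "p = (x, z')" by (cases p)
        moreover obtain F where "F \<in> S" using S by blast
        ultimately have "x \<in> c" "?y F x \<le> z'" using mem_region_iff[OF lam0 S(1)] by auto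
        moreover have "0 \<le> ?y F x"
          using value_nonneg \<open>F \<in> S\<close> S \<open>x \<in> c\<close> cell_subset by blast
        ultimately show "p \<in> c \<times> {0..}" using p by simp
      qed
    next
      fix x z' assume v: "(x, z') extreme_point_of region lam0 S"
      then have x: "x \<in> c" using mem_region_iff[OF lam0 S(1)] by (auto simp: extreme_point_of_def)
      then have x\<Lambda>: "x \<in> \<Lambda>" using cell_subset by blast
      have "?k * ?y G x \<le> (1 - \<epsilon>) * ?y (ORC x) x"
        using oracle_value[OF x\<Lambda> G] eps by (simp add: mult.assoc)
      also have "\<dots> \<le> z'"
        using vertices[OF v] value_on_cell[OF lam0 x oracle_strategy[OF x\<Lambda>]] by simp
      finally show "?d + ?n \<bullet> x \<le> z'" using affine[OF x] by simp
    qed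
    then show ?thesis using affine mem mem_region_iff[OF lam0 S(1)] by simp
  qed
  have "\<exists>F\<in>S. ?y F lam \<ge> (1 - \<epsilon>) * \<beta> * y_opt E a b l Bas lam" if lam: "lam \<in> c" for lam
  proof -
    have finS: "finite S" using S finite_strategies finite_subset by blast
    have "Max ((\<lambda>F. ?y F lam) ` S) \<in> (\<lambda>F. ?y F lam) ` S" using finS S by (intro Max_in) auto
    then obtain F where F: "F \<in> S" "Max ((\<lambda>F. ?y F lam) ` S) = ?y F lam" by blast
    then have "?y G lam \<le> ?y F lam" if "G \<in> S" for G
      using finS that Max_ge[of "(\<lambda>F. ?y F lam) ` S"] by force
    then have low: "(lam, ?y F lam) \<in> region lam0 S"
      using lam mem_region_iff[OF lam0 S(1)] by simp
    have "y_opt E a b l Bas lam \<in> (\<lambda>F. ?y F lam) ` strategies E l"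
      unfolding y_opt_def using finite_strategies S by (intro Max_in) auto
    then obtain G where "G \<in> strategies E l" "y_opt E a b l Bas lam = ?y G lam" by blast
    then show ?thesis using bound[OF _ low] F(1) by auto
  qed
  then show ?thesis
    using S finite_subset[OF S(1) finite_strategies] by (simp add: is_approximation_def)
qed

fun invariant :: "('e, real ^ 'p::{finite,linorder}) state \<Rightarrow> bool" where
  "invariant Start \<longleftrightarrow> True"
| "invariant (Running lam0 S A X) \<longleftrightarrow>
     lam0 \<in> interior c \<and> S \<subseteq> strategies E l \<and> S \<noteq> {} \<and> A = region lam0 S \<and>
     (\<forall>(lam, z)\<in>X. (1 - \<epsilon>) * set_weight a b (Bas lam0 (ORC lam)) lam \<le> z)"
| "invariant (Returned S) \<longleftrightarrow> is_approximation E a b l Bas ((1 - \<epsilon>) * \<beta>) c S"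

text \<open>
  A restart lowers the second component and may raise the third; examining a vertex lowers the third
  and keeps the second.  The first component takes care of the first and the last step.
\<close>

fun progress :: "('e, real ^ 'p::{finite,linorder}) state \<Rightarrow> nat \<times> nat \<times> nat" where
  "progress Start = (2, 0, 0)"
| "progress (Running lam0 S A X) =
     (1, card (strategies E l - S), card ({v. v extreme_point_of A} - X))"
| "progress (Returned S) = (0, 0, 0)"

abbreviation progress_order :: "((nat \<times> nat \<times> nat) \<times> (nat \<times> nat \<times> nat)) set" where
  "progress_order \<equiv> less_than <*lex*> less_than <*lex*> less_than"

abbreviation step where "step \<equiv> cell_step a b Bas ORC \<epsilon> c"

lemma vertex_oracle_strategy:
  assumes "invariant (Running lam0 S A X)" "(lam, z) extreme_point_of A"
  shows "lam \<in> c" "ORC lam \<in> strategies E l"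
proof -
  show "lam \<in> c" using assms mem_region_iff by (auto simp: extreme_point_of_def)
  then show "ORC lam \<in> strategies E l" using cell_subset oracle_strategy by blast
qed

text \<open>
  If the answer of \<open>ORC\<close> already belonged to \<open>S\<close>, the vertex would lie above its value, which, being
  nonnegative, does not grow by the factor \<open>1 - \<epsilon>\<close>.
\<close>

lemma restart_strategy_new:
  assumes inv: "invariant (Running lam0 S A X)" and v: "(lam, z) extreme_point_of A"
    and violated: "(1 - \<epsilon>) * set_weight a b (Bas lam0 (ORC lam)) lam > z"
  shows "ORC lam \<notin> S"
proof
  assume "ORC lam \<in> S"
  note strat = vertex_oracle_strategy[OF inv v]
  let ?y = "y_strategy a b Bas (ORC lam) lam"
  have "?y \<le> z"
    using inv v \<open>ORC lam \<in> S\<close> mem_region_iff by (auto simp: extreme_point_of_def)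
  moreover have "0 \<le> ?y" using value_nonneg strat cell_subset by blast
  then have "(1 - \<epsilon>) * ?y \<le> ?y" using eps by (simp add: mult_left_le_one_le)
  moreover have "set_weight a b (Bas lam0 (ORC lam)) lam = ?y" using value_on_cell inv strat by simp
  ultimately show False using violated by simp
qed

lemma step_invariant_progress:
  assumes "step s s'" "invariant s"
  shows "invariant s' \<and> (progress s', progress s) \<in> progress_order"
  using assms
proof cases
  case (initialise lam0 F0)
  have "lam0 \<in> \<Lambda>" using initialise interior_subset cell_subset by blast
  then show ?thesis using initialise oracle_strategy by (simp add: region_def)
next
  case (restart lam z A X F lam0 S)
  have inv: "invariant (Running lam0 S A X)" using restart assms by simp
  have F: "F \<in> strategies E l" "F \<notin> S"
    using vertex_oracle_strategy[OF inv] restart_strategy_new[OF inv] restart by auto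
  then have "card (strategies E l - (S \<union> {F})) < card (strategies E l - S)"
    using finite_strategies by (intro psubset_card_mono) auto
  moreover have "region lam0 S \<inter> phi a b Bas lam0 F = region lam0 (S \<union> {F})"
    by (auto simp: region_def)
  ultimately show ?thesis using restart inv F by simp
next
  case (next_vertex lam z A X F lam0 S)
  have inv: "invariant (Running lam0 S A X)" using next_vertex assms by simp
  then have "polyhedron A" using polyhedron_region by simp
  then have "finite {v. v extreme_point_of A}" by (rule finite_polyhedron_extreme_points)
  then have "card ({v. v extreme_point_of A} - insert (lam, z) X) < card ({v. v extreme_point_of A} - X)"
    using next_vertex by (intro psubset_card_mono) auto
  then show ?thesis using next_vertex inv by auto
next
  case (return A X lam0 S)
  have inv: "invariant (Running lam0 S A X)" using return assms by simp
  have "is_approximation E a b l Bas ((1 - \<epsilon>) * \<beta>) c S"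
  proof (rule approximation_if_vertices_examined)
    fix lam z assume "(lam, z) extreme_point_of region lam0 S"
    then have "(lam, z) \<in> X" using return(3) inv by simp
    then show "(1 - \<epsilon>) * set_weight a b (Bas lam0 (ORC lam)) lam \<le> z" using inv by auto
  qed (use inv in auto)
  then show ?thesis using return by simp
qed

lemma reachable_invariant: "step\<^sup>*\<^sup>* Start s \<Longrightarrow> invariant s"
  by (induction rule: rtranclp_induct) (simp, blast dest: step_invariant_progress)

lemma stuck_imp_returned:
  assumes "\<nexists>s'. step s s'"
  obtains S where "s = Returned S"
proof (cases s)
  case Start
  then show thesis using interior_cell_nonempty assms cell_step.initialise by blast
next
  case (Running lam0 S A X)
  show thesis
  proof (cases "\<exists>lam z. (lam, z) extreme_point_of A \<and> (lam, z) \<notin> X")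
    case True
    then obtain lam z where v: "(lam, z) extreme_point_of A" "(lam, z) \<notin> X" by blast
    show thesis
    proof (cases "(1 - \<epsilon>) * set_weight a b (Bas lam0 (ORC lam)) lam > z")
      case True
      then show thesis using assms Running cell_step.restart[OF v refl] by blast
    next
      case False
      then show thesis using assms Running cell_step.next_vertex[OF v refl] by blast
    qed
  next
    case False
    then have "v \<in> X" if "v extreme_point_of A" for v using that by (cases v) auto
    then show thesis using assms Running cell_step.return by blast
  qed
qed (use that in blast)

theorem computes_approximation:
  "computes step (is_approximation E a b l Bas ((1 - \<epsilon>) * \<beta>) c)"
  unfolding computes_def
proof (intro conjI allI impI)
  show "\<nexists>run. run 0 = Start \<and> (\<forall>i. step (run i) (run (Suc i)))"
  proof
    assume "\<exists>run. run 0 = Start \<and> (\<forall>i. step (run i) (run (Suc i)))"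
    then obtain run where run: "run 0 = Start" "\<And>i. step (run i) (run (Suc i))" by blast
    have inv: "invariant (run i)" for i
    proof (induction i)
      case (Suc i)
      then show ?case using step_invariant_progress[OF run(2)] by blast
    qed (simp add: run(1))
    have "(progress (run (Suc i)), progress (run i)) \<in> progress_order" for i
      using step_invariant_progress[OF run(2) inv] by blast
    moreover have "wf progress_order" by (intro wf_lex_prod wf_less_than)
    ultimately show False
      using wf_no_infinite_down_chainE[of progress_order "\<lambda>i. progress (run i)"] by blast
  qed
next
  fix s assume s: "step\<^sup>*\<^sup>* Start s \<and> (\<nexists>s'. step s s')"
  then obtain S where "s = Returned S" using stuck_imp_returned by blast
  then show "\<exists>S. s = Returned S \<and> is_approximation E a b l Bas ((1 - \<epsilon>) * \<beta>) c S"
    using reachable_invariant[of s] s by auto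
qed

end

theorem theorem4p1:
  fixes E :: "'e set" and Ind :: "'e set set"
    and a :: "'e \<Rightarrow> real" and b :: "'p::{finite,linorder} \<Rightarrow> 'e \<Rightarrow> real"
    and l :: nat and \<Lambda> c :: "(real ^ 'p::{finite,linorder}) set"
    and Bas :: "real ^ 'p::{finite,linorder} \<Rightarrow> 'e set \<Rightarrow> 'e set"
    and ORC :: "real ^ 'p::{finite,linorder} \<Rightarrow> 'e set"
    and \<epsilon> \<beta> :: real
  assumes "0 < \<epsilon>" and "\<epsilon> < 1" and "0 < \<beta>" and "\<beta> \<le> 1"
    and "interdiction_instance E Ind a b l \<Lambda>"
    and "min_basis_choice E Ind a b l \<Lambda> Bas"
    and "is_oracle E a b l \<Lambda> Bas \<beta> ORC"
    and "is_cell (arrangement E a b \<Lambda>) \<Lambda> c"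
  shows "computes (cell_step a b Bas ORC \<epsilon> c)
           (is_approximation E a b l Bas ((1 - \<epsilon>) * \<beta>) c)"
proof -
  interpret cell_algorithm E Ind a b l \<Lambda> c Bas ORC \<epsilon> \<beta>
    using assms by (intro cell_algorithm.intro cell_algorithm_axioms.intro)
  show ?thesis by (rule computes_approximation)
qed

end
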